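(* Assume $x(0)=x'(0)=0$. Let $L_3(t,s)=(\omega^3-\omega)\sin(\omega(t-s))+2\omega^2\cos(\omega(t-s))$. Then $x(t)\to0$ as $t\to\infty$ if and only if $y_2(t)\to0$ as $t\to\infty$ and \[ \lim_{t\to\infty}\int_0^tE(t,s)L_3(t,s)y_2(s)\,ds=0. \]
   Context: Standing assumptions: $\omega>0$ is a constant; $p\in C^1([0,\infty))$ with $p(t)>0$ and $p'(t)<0$ for all $t\ge0$, $\int_0^\infty p(t)\,dt=\infty$ and $\int_0^\infty p(t)^2\,dt<\infty$; $f\in L^1_{\mathrm{loc}}([0,\infty))$. $x$ denotes the solution of $x''(t)+p(t)x'(t)+\omega^2x(t)=f(t)$, $t\ge0$. Notation: $E(t,s)=\exp(-\frac12\int_s^tp(\tau)\,d\tau)$ for $0\le s\le t$; $y_1(t)=\int_0^te^{-\omega^2(t-s)}f(s)\,ds$; $y_2(t)=\int_0^te^{-\omega^2(t-s)}y_1(s)\,ds=\int_0^t(t-s)e^{-\omega^2(t-s)}f(s)\,ds$. *)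

theory Defs
  imports "HOL-Analysis.Analysis"
begin

definition Efac :: "(real \<Rightarrow> real) \<Rightarrow> real \<Rightarrow> real \<Rightarrow> real" where
  "Efac p t s = exp (- (1/2) * integral {s..t} p)"

definition y1 :: "real \<Rightarrow> (real \<Rightarrow> real) \<Rightarrow> real \<Rightarrow> real" where
  "y1 \<omega> f t = integral {0..t} (\<lambda>s. exp (- (\<omega>^2) * (t - s)) * f s)"

definition y2 :: "real \<Rightarrow> (real \<Rightarrow> real) \<Rightarrow> real \<Rightarrow> real" where
  "y2 \<omega> f t = integral {0..t} (\<lambda>s. exp (- (\<omega>^2) * (t - s)) * y1 \<omega> f s)"

definition L3 :: "real \<Rightarrow> real \<Rightarrow> real \<Rightarrow> real" where
  "L3 \<omega> t s = (\<omega>^3 - \<omega>) * sin (\<omega> * (t - s)) + 2 * \<omega>^2 * cos (\<omega> * (t - s))"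

end

(* Write a = \<omega>^2, y = y2, P(t) = \<integral>_0^t p and q = p'/2 + p^2/4; q is absolutely integrable because
   p' < 0 < p and p^2 is integrable. Differentiating E(t,s) [cos(\<omega>(t-s)) u(s) + sin(\<omega>(t-s)) n(s) / \<omega>]
   in s, for u = x - y and a suitable n, yields

     x(t) = y(t) + \<integral>_0^t E L3 y + \<integral>_0^t E (-p (cos + \<omega> sin) + q sin / \<omega>) y + \<integral>_0^t E (q sin / \<omega>) x.

   Now \<integral>_0^t E(t,s) h(s) ds tends to 0 whenever h is integrable, or h = p g with g tending to 0, because
   E(t,s) = exp((P(s) - P(t))/2) and P tends to infinity. So the last integral vanishes in the limit
   if x is bounded, and the one before it if y tends to 0. This gives the equivalence, given that x is
   bounded when the other terms vanish in the limit (the tail of \<integral> |q| being small) and that x \<rightarrow> 0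
   forces y \<rightarrow> 0 (y arises from x by solving two stable scalar linear equations). *)

theory Submission
  imports Defs
begin

section \<open>Integration by parts\<close>

lemma integral_diff_subinterval:
  fixes f :: "real \<Rightarrow> real"
  assumes "a \<le> s" "s \<le> t" "f integrable_on {a..t}"
  shows "integral {a..t} f - integral {a..s} f = integral {s..t} f"
  using Henstock_Kurzweil_Integration.integral_combine[OF assms] by simp

text \<open>The difference of the two sides, viewed as a function \<open>H\<close> of the upper
  limit, has increments bounded by \<open>2 * K * (t - s) * (N t - N s)\<close>. Here
  \<open>K\<close> bounds \<open>\<phi>'\<close> and \<open>N\<close> is the continuous indefinite
  integral of |f|, so \<open>H\<close> is constant. This form of the rule makes \<open>y1\<close>
  accessible when \<open>f\<close> is merely integrable.\<close>

lemma integral_by_parts_absolutely_integrable: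
  fixes \<phi> \<phi>' f :: "real \<Rightarrow> real"
  assumes ab: "a \<le> b" and f: "f absolutely_integrable_on {a..b}"
    and \<phi>'_cont: "continuous_on {a..b} \<phi>'"
    and \<phi>: "\<And>t. t \<in> {a..b} \<Longrightarrow> (\<phi> has_real_derivative \<phi>' t) (at t within {a..b})"
  shows "integral {a..b} (\<lambda>s. \<phi> s * f s) =
    \<phi> b * integral {a..b} f - integral {a..b} (\<lambda>s. \<phi>' s * integral {a..s} f)"
proof -
  define F where "F t = integral {a..t} f" for t
  define N where "N t = integral {a..t} (\<lambda>s. \<bar>f s\<bar>)" for t
  define H where "H t = integral {a..t} (\<lambda>s. \<phi> s * f s) - \<phi> t * F t
    + integral {a..t} (\<lambda>s. \<phi>' s * F s)" for t
  have f_int: "f integrable_on {a..b}" and absf_int: "(\<lambda>s. \<bar>f s\<bar>) integrable_on {a..b}"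
    using f by (auto simp: absolutely_integrable_on_def)
  have F_cont: "continuous_on {a..b} F" and N_cont: "continuous_on {a..b} N"
    unfolding F_def N_def by (intro indefinite_integral_continuous_1 f_int absf_int)+
  have \<phi>_cont: "continuous_on {a..b} \<phi>"
    using \<phi> by (meson DERIV_continuous_on)
  have mult_int: "(\<lambda>s. g s * f s) integrable_on {a..b}" if "continuous_on {a..b} g" for g
  proof -
    have "(\<lambda>s. g s * f s) absolutely_integrable_on {a..b}"
      using that f
      by (intro absolutely_integrable_bounded_measurable_product_real
          continuous_imp_measurable_on_sets_lebesgue compact_imp_bounded compact_continuous_image) auto
    then show ?thesis by (simp add: absolutely_integrable_on_def)
  qed
  obtain K where K: "\<And>t. t \<in> {a..b} \<Longrightarrow> \<bar>\<phi>' t\<bar> \<le> K" and K0: "K > 0"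
  proof -
    have "bounded (\<phi>' ` {a..b})"
      using \<phi>'_cont by (intro compact_imp_bounded compact_continuous_image) auto
    then show ?thesis using that by (force simp: bounded_pos)
  qed
  have sub: "g integrable_on {s..t}" if "g integrable_on {a..b}" "a \<le> s" "t \<le> b" for g :: "real \<Rightarrow> real" and s t
    using that by (auto intro: integrable_on_subinterval)
  have N_diff: "N t - N s = integral {s..t} (\<lambda>s. \<bar>f s\<bar>)" if "a \<le> s" "s \<le> t" "t \<le> b" for s t
    unfolding N_def using that by (intro integral_diff_subinterval sub[OF absf_int]) auto
  have F_diff: "F t - F s = integral {s..t} f" if "a \<le> s" "s \<le> t" "t \<le> b" for s t
    unfolding F_def using that by (intro integral_diff_subinterval sub[OF f_int]) auto
  have N_mono: "N s \<le> N t" if "a \<le> s" "s \<le> t" "t \<le> b" for s t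
  proof -
    have "0 \<le> integral {s..t} (\<lambda>s. \<bar>f s\<bar>)" using that by (intro integral_nonneg sub[OF absf_int]) auto
    then show ?thesis using N_diff[OF that] by simp
  qed
  have F_le: "\<bar>F t - F s\<bar> \<le> N t - N s" if "a \<le> s" "s \<le> t" "t \<le> b" for s t
    unfolding F_diff[OF that] N_diff[OF that]
    using that integral_norm_bound_integral[OF sub[OF f_int] sub[OF absf_int]] by auto
  have \<phi>_diff: "(\<phi>' has_integral (\<phi> t - \<phi> s)) {s..t}" if "a \<le> s" "s \<le> t" "t \<le> b" for s t
    using that
    by (intro fundamental_theorem_of_calculus)
       (auto simp flip: has_real_derivative_iff_has_vector_derivative intro!: DERIV_subset[OF \<phi>])
  have \<phi>_lip: "\<bar>\<phi> t - \<phi> s\<bar> \<le> K * (t - s)" if "a \<le> s" "s \<le> t" "t \<le> b" for s t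
    using has_integral_bound[OF _ \<phi>_diff[OF that, folded box_real(2)], of K] K K0 that by auto
  have H_le: "\<bar>H t - H s\<bar> \<le> 2 * K * (t - s) * (N t - N s)" if st: "a \<le> s" "s \<le> t" "t \<le> b" for s t
  proof -
    have i1: "(\<lambda>r. (\<phi> r - \<phi> t) * f r) integrable_on {s..t}"
      using st by (intro sub[OF mult_int] continuous_intros \<phi>_cont) auto
    have i1': "(\<lambda>r. \<phi> r * f r) integrable_on {s..t}"
      using st by (intro sub[OF mult_int] continuous_intros \<phi>_cont) auto
    have i2: "(\<lambda>r. \<phi>' r * (F r - F s)) integrable_on {s..t}"
      using st by (intro sub[OF integrable_continuous_interval] continuous_intros \<phi>'_cont F_cont) auto
    have i2': "(\<lambda>r. \<phi>' r * F r) integrable_on {s..t}"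
      using st by (intro sub[OF integrable_continuous_interval] continuous_intros \<phi>'_cont F_cont) auto
    have e1: "integral {s..t} (\<lambda>r. (\<phi> r - \<phi> t) * f r)
      = integral {s..t} (\<lambda>r. \<phi> r * f r) - \<phi> t * (F t - F s)"
      using st i1' sub[OF f_int, of s t] unfolding F_diff[OF st]
      by (simp add: left_diff_distrib integral_diff integrable_on_mult_right)
    have e2: "integral {s..t} (\<lambda>r. \<phi>' r * (F r - F s))
      = integral {s..t} (\<lambda>r. \<phi>' r * F r) - (\<phi> t - \<phi> s) * F s"
      using i2' \<phi>_diff[OF st]
      by (simp add: right_diff_distrib integral_diff has_integral_integrable[of \<phi>'] integrable_on_mult_left
          integral_unique)
    have d1: "integral {a..t} (\<lambda>r. \<phi> r * f r) - integral {a..s} (\<lambda>r. \<phi> r * f r)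
       = integral {s..t} (\<lambda>r. \<phi> r * f r)"
      using st by (intro integral_diff_subinterval sub[OF mult_int] \<phi>_cont) auto
    have d2: "integral {a..t} (\<lambda>r. \<phi>' r * F r) - integral {a..s} (\<lambda>r. \<phi>' r * F r)
       = integral {s..t} (\<lambda>r. \<phi>' r * F r)"
      using st
      by (intro integral_diff_subinterval sub[OF integrable_continuous_interval] continuous_intros
            \<phi>'_cont F_cont) auto
    \<comment> \<open>Recentring \<open>\<phi>\<close> at \<open>t\<close> and \<open>F\<close> at
      \<open>s\<close> uses up the boundary term exactly: \<open>\<phi> t * (F t - F s) + (\<phi> t
      - \<phi> s) * F s = \<phi> t * F t - \<phi> s * F s\<close>. Both remaining integrands now
      carry a small factor.\<close>
    have eq: "H t - H s = integral {s..t} (\<lambda>r. (\<phi> r - \<phi> t) * f r)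
       + integral {s..t} (\<lambda>r. \<phi>' r * (F r - F s))"
      unfolding e1 e2 H_def using d1 d2 by (simp add: algebra_simps)
    have b1: "\<bar>integral {s..t} (\<lambda>r. (\<phi> r - \<phi> t) * f r)\<bar> \<le> integral {s..t} (\<lambda>r. K * (t - s) * \<bar>f r\<bar>)"
    proof -
      have "\<bar>\<phi> r - \<phi> t\<bar> \<le> K * (t - s)" if "r \<in> {s..t}" for r
      proof -
        have "\<bar>\<phi> r - \<phi> t\<bar> \<le> K * (t - r)" using \<phi>_lip[of r t] st that by (auto simp: abs_minus_commute)
        also have "\<dots> \<le> K * (t - s)" using that K0 by simp
        finally show ?thesis .
      qed
      then have "\<bar>(\<phi> r - \<phi> t) * f r\<bar> \<le> K * (t - s) * \<bar>f r\<bar>" if "r \<in> {s..t}" for r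
        using that by (auto simp: abs_mult intro!: mult_right_mono)
      then show ?thesis
        using integral_norm_bound_integral[OF i1 integrable_on_mult_right[OF sub[OF absf_int]], of "K * (t - s)"] st
        by auto
    qed
    have b2: "\<bar>integral {s..t} (\<lambda>r. \<phi>' r * (F r - F s))\<bar> \<le> integral {s..t} (\<lambda>r. K * (N t - N s))"
    proof -
      have "\<bar>F r - F s\<bar> \<le> N t - N s" if "r \<in> {s..t}" for r
        using F_le[of s r] N_mono[of r t] st that by auto
      then have "\<bar>\<phi>' r * (F r - F s)\<bar> \<le> K * (N t - N s)" if "r \<in> {s..t}" for r
        using K[of r] K0 that st by (auto simp: abs_mult intro!: mult_mono)
      then show ?thesis
        using integral_norm_bound_integral[OF i2 integrable_const_ivl, of "K * (N t - N s)"] by auto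
    qed
    have "\<bar>integral {s..t} (\<lambda>r. (\<phi> r - \<phi> t) * f r)\<bar> \<le> K * (t - s) * (N t - N s)"
      using b1 N_diff[OF st] by simp
    moreover have "\<bar>integral {s..t} (\<lambda>r. \<phi>' r * (F r - F s))\<bar> \<le> K * (t - s) * (N t - N s)"
      using b2 st by (simp add: mult_ac)
    ultimately show ?thesis
      using eq by linarith
  qed
  (* f is only integrable, so F need not be differentiable, but the increments of H are
     the product of two small quantities and hence H' = 0 everywhere. *)
  have "(H has_real_derivative 0) (at t within {a..b})" if t: "t \<in> {a..b}" for t
  proof -
    have lim: "((\<lambda>s. 2 * K * \<bar>N s - N t\<bar>) \<longlongrightarrow> 2 * K * \<bar>N t - N t\<bar>) (at t within {a..b})"
      using N_cont t by (intro tendsto_intros) (auto simp: continuous_on_def)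
    have bound: "\<forall>\<^sub>F s in at t within {a..b}. norm ((H s - H t) / (s - t)) \<le> 2 * K * \<bar>N s - N t\<bar>"
      unfolding eventually_at_filter
    proof (intro always_eventually allI impI)
      fix s assume s: "s \<noteq> t" "s \<in> {a..b}"
      have "\<bar>H s - H t\<bar> \<le> 2 * K * \<bar>s - t\<bar> * \<bar>N s - N t\<bar>"
      proof (cases "s \<le> t")
        case True
        then have "\<bar>s - t\<bar> = t - s" "\<bar>N s - N t\<bar> = N t - N s" "\<bar>H s - H t\<bar> = \<bar>H t - H s\<bar>"
          using N_mono[of s t] s t by auto
        then show ?thesis using H_le[of s t] True s t by simp
      next
        case False
        then have "\<bar>s - t\<bar> = s - t" "\<bar>N s - N t\<bar> = N s - N t"
          using N_mono[of t s] s t by auto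
        then show ?thesis using H_le[of t s] False s t by simp
      qed
      then show "norm ((H s - H t) / (s - t)) \<le> 2 * K * \<bar>N s - N t\<bar>"
        using s by (simp add: abs_divide pos_divide_le_eq mult_ac)
    qed
    have "((\<lambda>s. (H s - H t) / (s - t)) \<longlongrightarrow> 0) (at t within {a..b})"
      by (rule Lim_null_comparison[OF bound]) (use lim in simp)
    then show ?thesis by (simp add: has_field_derivative_iff)
  qed
  then obtain c where "\<And>t. t \<in> {a..b} \<Longrightarrow> H t = c"
    using has_field_derivative_zero_constant[of "{a..b}" H] by auto
  then have "H b = H a" using ab by auto
  then show ?thesis by (simp add: H_def F_def)
qed

section \<open>Exponentially weighted integrals\<close>

text \<open>Only a neighbourhood of \<open>t\<close> matters, so the compact interval up to
  \<open>t + 1\<close> can stand in for the half-line.\<close>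

lemma has_real_derivative_integral_atLeast:
  fixes g :: "real \<Rightarrow> real"
  assumes "continuous_on {a..} g" "t \<ge> a"
  shows "((\<lambda>x. integral {a..x} g) has_real_derivative g t) (at t within {a..})"
proof -
  have "((\<lambda>x. integral {a..x} g) has_real_derivative g t) (at t within {a..t + 1})"
    using assms by (intro integral_has_real_derivative continuous_on_subset[OF assms(1)]) auto
  moreover have "at t within {a..} = at t within {a..t + 1}"
    by (rule at_within_nhd[of _ "{..<t + 1}"]) auto
  ultimately show ?thesis by simp
qed

lemma integral_derivative_atLeast:
  fixes g g' :: "real \<Rightarrow> real"
  assumes "\<And>s. s \<ge> a \<Longrightarrow> (g has_real_derivative g' s) (at s within {a..})" "a \<le> t"
  shows "integral {a..t} g' = g t - g a"
  using assms
  by (intro integral_unique fundamental_theorem_of_calculus)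
     (auto simp flip: has_real_derivative_iff_has_vector_derivative intro!: DERIV_subset[OF assms(1)])

lemma integrable_continuous_atLeast:
  fixes g :: "real \<Rightarrow> real"
  assumes "continuous_on {a..} g" "a \<le> s"
  shows "g integrable_on {s..t}"
  using assms by (intro integrable_continuous_real continuous_on_subset[OF assms(1)]) auto

text \<open>For fixed \<open>T\<close> the integral over \<open>{0..T}\<close> factors as
  \<open>C * exp (- \<Phi> t)\<close>, which dies out. It is therefore enough that the contribution
  from \<open>T\<close> onwards be small uniformly in \<open>t\<close>.\<close>

lemma exp_weighted_integral_tendsto_0:
  fixes \<Phi> h :: "real \<Rightarrow> real"
  assumes \<Phi>_cont: "continuous_on {0..} \<Phi>" and \<Phi>_lim: "filterlim \<Phi> at_top at_top"
    and h_cont: "continuous_on {0..} h"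
    and tail: "\<And>\<epsilon>. \<epsilon> > 0 \<Longrightarrow>
      \<exists>T\<ge>0. \<forall>t\<ge>T. \<bar>integral {T..t} (\<lambda>s. exp (\<Phi> s - \<Phi> t) * h s)\<bar> \<le> \<epsilon>"
  shows "((\<lambda>t. integral {0..t} (\<lambda>s. exp (\<Phi> s - \<Phi> t) * h s)) \<longlongrightarrow> 0) at_top"
proof (rule tendstoI)
  fix e :: real assume "e > 0"
  then obtain T where T: "T \<ge> 0"
    "\<And>t. t \<ge> T \<Longrightarrow> \<bar>integral {T..t} (\<lambda>s. exp (\<Phi> s - \<Phi> t) * h s)\<bar> \<le> e / 2"
    using tail[of "e / 2"] by auto
  define C where "C = integral {0..T} (\<lambda>s. exp (\<Phi> s) * h s)"
  have "((\<lambda>t. C * exp (- \<Phi> t)) \<longlongrightarrow> C * 0) at_top"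
    by (intro tendsto_mult tendsto_const filterlim_compose[OF exp_at_bot]
        filterlim_uminus_at_bot_at_top[THEN filterlim_compose] \<Phi>_lim)
  then have "\<forall>\<^sub>F t in at_top. \<bar>C * exp (- \<Phi> t)\<bar> < e / 2"
    using \<open>e > 0\<close> by (auto dest!: tendstoD[of _ _ _ "e / 2"])
  then show "\<forall>\<^sub>F t in at_top. dist (integral {0..t} (\<lambda>s. exp (\<Phi> s - \<Phi> t) * h s)) 0 < e"
    using eventually_ge_at_top[of T]
  proof eventually_elim
    case (elim t)
    have "integral {0..T} (\<lambda>s. exp (\<Phi> s - \<Phi> t) * h s) + integral {T..t} (\<lambda>s. exp (\<Phi> s - \<Phi> t) * h s)
      = integral {0..t} (\<lambda>s. exp (\<Phi> s - \<Phi> t) * h s)"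
      using T elim
      by (intro Henstock_Kurzweil_Integration.integral_combine integrable_continuous_atLeast[of 0]
          continuous_intros \<Phi>_cont h_cont) auto
    moreover have "integral {0..T} (\<lambda>s. exp (\<Phi> s - \<Phi> t) * h s)
       = integral {0..T} (\<lambda>s. exp (- \<Phi> t) * (exp (\<Phi> s) * h s))"
      by (simp add: exp_diff exp_minus field_simps)
    ultimately show ?case
      using T(2)[of t] elim by (simp add: C_def mult.commute)
  qed
qed

text \<open>\<open>T\<close> is chosen so that the integral up to \<open>T\<close> lies within
  \<open>\<epsilon>\<close> of the supremum of all such integrals; no later integral exceeds that
  supremum.\<close>

lemma integral_tail_le:
  fixes m :: "real \<Rightarrow> real"
  assumes m_cont: "continuous_on {0..} m" and m_nonneg: "\<And>s. s \<ge> 0 \<Longrightarrow> m s \<ge> 0"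
    and bound: "\<And>t. t \<ge> 0 \<Longrightarrow> integral {0..t} m \<le> C" and "\<epsilon> > 0"
  obtains T where "T \<ge> 0" "\<And>t. t \<ge> T \<Longrightarrow> integral {T..t} m \<le> \<epsilon>"
proof -
  let ?S = "(\<lambda>t. integral {0..t} m) ` {0..}"
  have bdd: "bdd_above ?S" using bound by (intro bdd_aboveI2[of _ _ C]) auto
  obtain T where T: "T \<ge> 0" "Sup ?S - \<epsilon> < integral {0..T} m"
    using less_cSup_iff[of ?S "Sup ?S - \<epsilon>"] bdd \<open>\<epsilon> > 0\<close> by auto
  show ?thesis
  proof
    fix t assume "t \<ge> T"
    moreover have "integral {0..t} m \<le> Sup ?S"
      using T \<open>t \<ge> T\<close> by (intro cSup_upper bdd) auto
    moreover have "integral {0..T} m + integral {T..t} m = integral {0..t} m"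
      using T \<open>t \<ge> T\<close> m_cont
      by (intro Henstock_Kurzweil_Integration.integral_combine integrable_continuous_atLeast[of 0]) auto
    ultimately show "integral {T..t} m \<le> \<epsilon>" using T by simp
  qed (use T in auto)
qed

text \<open>Since \<open>\<Phi>\<close> increases, the weight is at most 1, and the tail is
  controlled by the tail of the integral of the majorant \<open>m\<close>.\<close>

lemma exp_weighted_integral_integrable_tendsto_0:
  fixes \<Phi> h m :: "real \<Rightarrow> real"
  assumes \<Phi>_cont: "continuous_on {0..} \<Phi>" and \<Phi>_lim: "filterlim \<Phi> at_top at_top"
    and \<Phi>_mono: "\<And>s t. 0 \<le> s \<Longrightarrow> s \<le> t \<Longrightarrow> \<Phi> s \<le> \<Phi> t"
    and h_cont: "continuous_on {0..} h"
    and m_cont: "continuous_on {0..} m"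
    and bound: "\<And>t. t \<ge> 0 \<Longrightarrow> integral {0..t} m \<le> C"
    and h_le: "\<And>s. s \<ge> 0 \<Longrightarrow> \<bar>h s\<bar> \<le> m s"
  shows "((\<lambda>t. integral {0..t} (\<lambda>s. exp (\<Phi> s - \<Phi> t) * h s)) \<longlongrightarrow> 0) at_top"
proof (rule exp_weighted_integral_tendsto_0[OF \<Phi>_cont \<Phi>_lim h_cont])
  fix \<epsilon> :: real assume "\<epsilon> > 0"
  have "m s \<ge> 0" if "s \<ge> 0" for s using h_le[OF that] by linarith
  then obtain T where T: "T \<ge> 0" "\<And>t. t \<ge> T \<Longrightarrow> integral {T..t} m \<le> \<epsilon>"
    using integral_tail_le[OF m_cont _ bound \<open>\<epsilon> > 0\<close>] by blast
  have "\<bar>integral {T..t} (\<lambda>s. exp (\<Phi> s - \<Phi> t) * h s)\<bar> \<le> \<epsilon>" if "t \<ge> T" for t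
  proof -
    have *: "\<bar>exp (\<Phi> s - \<Phi> t) * h s\<bar> \<le> m s" if "s \<in> {T..t}" for s
      using mult_mono[of "exp (\<Phi> s - \<Phi> t)" 1 "\<bar>h s\<bar>" "m s"] that T(1) \<Phi>_mono[of s t] h_le[of s]
      by (auto simp: abs_mult)
    have "norm (integral {T..t} (\<lambda>s. exp (\<Phi> s - \<Phi> t) * h s)) \<le> integral {T..t} m"
      using T(1) * by (intro integral_norm_bound_integral integrable_continuous_atLeast[of 0]
          continuous_intros \<Phi>_cont h_cont m_cont) auto
    then show ?thesis using T(2)[OF that] by simp
  qed
  then show "\<exists>T\<ge>0. \<forall>t\<ge>T. \<bar>integral {T..t} (\<lambda>s. exp (\<Phi> s - \<Phi> t) * h s)\<bar> \<le> \<epsilon>"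
    using T(1) by blast
qed

text \<open>The product \<open>exp (\<Phi> s - \<Phi> t) * \<Phi>' s\<close> is the derivative in
  \<open>s\<close> of the weight, so its integral over \<open>{T..t}\<close> is at most 1. The tail
  is then at most the size of \<open>g\<close> beyond \<open>T\<close>, even where
  \<open>\<Phi>'\<close> itself has infinite integral.\<close>

lemma exp_weighted_integral_derivative_tendsto_0:
  fixes \<Phi> \<Phi>' h g :: "real \<Rightarrow> real"
  assumes \<Phi>: "\<And>t. t \<ge> 0 \<Longrightarrow> (\<Phi> has_real_derivative \<Phi>' t) (at t within {0..})"
    and \<Phi>'_cont: "continuous_on {0..} \<Phi>'" and \<Phi>'_nonneg: "\<And>t. t \<ge> 0 \<Longrightarrow> \<Phi>' t \<ge> 0"
    and \<Phi>_lim: "filterlim \<Phi> at_top at_top"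
    and h_cont: "continuous_on {0..} h" and g_lim: "(g \<longlongrightarrow> 0) at_top"
    and h_le: "\<And>s. s \<ge> 0 \<Longrightarrow> \<bar>h s\<bar> \<le> \<Phi>' s * \<bar>g s\<bar>"
  shows "((\<lambda>t. integral {0..t} (\<lambda>s. exp (\<Phi> s - \<Phi> t) * h s)) \<longlongrightarrow> 0) at_top"
proof (rule exp_weighted_integral_tendsto_0[OF _ \<Phi>_lim h_cont])
  show \<Phi>_cont: "continuous_on {0..} \<Phi>" using \<Phi> by (auto intro!: DERIV_continuous_on)
  fix \<epsilon> :: real assume "\<epsilon> > 0"
  then have "\<forall>\<^sub>F t in at_top. t \<ge> 0 \<and> \<bar>g t\<bar> < \<epsilon>"
    using tendstoD[OF g_lim, of \<epsilon>] by (intro eventually_conj eventually_ge_at_top) auto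
  then obtain T where T: "\<And>t. t \<ge> T \<Longrightarrow> t \<ge> 0 \<and> \<bar>g t\<bar> < \<epsilon>"
    by (auto simp: eventually_at_top_linorder)
  have T0: "T \<ge> 0" using T[of T] by simp
  have "\<bar>integral {T..t} (\<lambda>s. exp (\<Phi> s - \<Phi> t) * h s)\<bar> \<le> \<epsilon>" if "t \<ge> T" for t
  proof -
    have *: "\<bar>exp (\<Phi> s - \<Phi> t) * h s\<bar> \<le> \<epsilon> * (exp (\<Phi> s - \<Phi> t) * \<Phi>' s)" if "s \<in> {T..t}" for s
    proof -
      have "\<Phi>' s * \<bar>g s\<bar> \<le> \<Phi>' s * \<epsilon>"
        using that T[of s] \<Phi>'_nonneg[of s] by (intro mult_left_mono) auto
      then have "\<bar>h s\<bar> \<le> \<epsilon> * \<Phi>' s" using h_le[of s] that T[of s] by (auto simp: mult.commute)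
      then show ?thesis by (simp add: abs_mult mult.left_commute)
    qed
    have "norm (integral {T..t} (\<lambda>s. exp (\<Phi> s - \<Phi> t) * h s))
       \<le> integral {T..t} (\<lambda>s. \<epsilon> * (exp (\<Phi> s - \<Phi> t) * \<Phi>' s))"
      using T0 * by (intro integral_norm_bound_integral integrable_continuous_atLeast[of 0]
          continuous_intros \<Phi>_cont h_cont \<Phi>'_cont) auto
    moreover have "integral {T..t} (\<lambda>s. exp (\<Phi> s - \<Phi> t) * \<Phi>' s) = exp (\<Phi> t - \<Phi> t) - exp (\<Phi> T - \<Phi> t)"
      using that T0
      by (intro integral_derivative_atLeast)
         (auto intro!: derivative_eq_intros DERIV_subset[OF \<Phi>])
    ultimately have "\<bar>integral {T..t} (\<lambda>s. exp (\<Phi> s - \<Phi> t) * h s)\<bar> \<le> \<epsilon> * (1 - exp (\<Phi> T - \<Phi> t))"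
      by simp
    also have "\<dots> \<le> \<epsilon> * 1" using \<open>\<epsilon> > 0\<close> by (intro mult_left_mono) auto
    finally show ?thesis by simp
  qed
  then show "\<exists>T\<ge>0. \<forall>t\<ge>T. \<bar>integral {T..t} (\<lambda>s. exp (\<Phi> s - \<Phi> t) * h s)\<bar> \<le> \<epsilon>"
    using T0 by blast
qed

section \<open>Linear equations on the half-line\<close>

lemma continuous_on_integral_atLeast:
  fixes f :: "real \<Rightarrow> real"
  assumes "\<And>t. t \<ge> a \<Longrightarrow> f integrable_on {a..t}"
  shows "continuous_on {a..} (\<lambda>t. integral {a..t} f)"
  unfolding continuous_on_eq_continuous_within
proof
  fix t assume t: "t \<in> {a..}"
  have "continuous (at t within {a..t + 1}) (\<lambda>t. integral {a..t} f)"
    using indefinite_integral_continuous_1[OF assms[of "t + 1"]] t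
    by (auto simp: continuous_on_eq_continuous_within)
  moreover have "at t within {a..} = at t within {a..t + 1}"
    using t by (intro at_within_nhd[of _ "{..<t + 1}"]) auto
  ultimately show "continuous (at t within {a..}) (\<lambda>t. integral {a..t} f)" by simp
qed

text \<open>Pulling \<open>exp (- c * t)\<close> out of the integral leaves a product to which the
  product rule and the fundamental theorem apply.\<close>

lemma has_real_derivative_exp_convolution:
  fixes g :: "real \<Rightarrow> real"
  assumes g: "continuous_on {0..} g" and t: "t \<ge> 0"
  shows "((\<lambda>t. integral {0..t} (\<lambda>s. exp (- c * (t - s)) * g s)) has_real_derivative
    g t - c * integral {0..t} (\<lambda>s. exp (- c * (t - s)) * g s)) (at t within {0..})"
proof -
  have eq: "integral {0..t} (\<lambda>s. exp (- c * (t - s)) * g s)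
    = exp (- c * t) * integral {0..t} (\<lambda>s. exp (c * s) * g s)" for t
  proof -
    have "exp (- c * (t - s)) * g s = exp (- c * t) * (exp (c * s) * g s)" for s
      by (simp add: algebra_simps flip: exp_add)
    then show ?thesis by (simp only: integral_mult_right)
  qed
  have "((\<lambda>t. integral {0..t} (\<lambda>s. exp (c * s) * g s)) has_real_derivative exp (c * t) * g t)
      (at t within {0..})"
    by (intro has_real_derivative_integral_atLeast continuous_intros g t)
  then show ?thesis
    unfolding eq by (auto intro!: derivative_eq_intros simp: exp_minus field_simps)
qed

text \<open>Integration by parts gives \<open>y1 = F - \<omega>^2 * G\<close>, where
  \<open>G\<close> is the exponential convolution of the continuous function \<open>F\<close>.
  Subtracting the rough part \<open>F\<close> leaves \<open>- \<omega>^2 * G\<close>, which is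
  differentiable although \<open>f\<close> is only integrable.\<close>

lemma
  assumes f: "\<And>t. t \<ge> 0 \<Longrightarrow> f absolutely_integrable_on {0..t}"
  shows continuous_on_y1: "continuous_on {0..} (y1 \<omega> f)"
    and has_real_derivative_y1_minus_integral: "t \<ge> 0 \<Longrightarrow> ((\<lambda>t. y1 \<omega> f t - integral {0..t} f) has_real_derivative
      - (\<omega>^2) * y1 \<omega> f t) (at t within {0..})"
proof -
  define F where "F t = integral {0..t} f" for t
  define G where "G t = integral {0..t} (\<lambda>s. exp (- (\<omega>^2) * (t - s)) * F s)" for t
  have F_cont: "continuous_on {0..} F"
    unfolding F_def using f by (intro continuous_on_integral_atLeast set_lebesgue_integral_eq_integral(1)) auto
  have G: "(G has_real_derivative F t - \<omega>^2 * G t) (at t within {0..})" if "t \<ge> 0" for t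
    unfolding G_def[abs_def] by (rule has_real_derivative_exp_convolution[OF F_cont that])
  have eq: "y1 \<omega> f t = F t - \<omega>^2 * G t" if "t \<ge> 0" for t
  proof -
    have "y1 \<omega> f t = exp (- (\<omega>^2) * (t - t)) * integral {0..t} f
      - integral {0..t} (\<lambda>s. (\<omega>^2 * exp (- (\<omega>^2) * (t - s))) * integral {0..s} f)"
      unfolding y1_def
      by (intro integral_by_parts_absolutely_integrable that f continuous_intros)
         (auto intro!: derivative_eq_intros)
    then show ?thesis
      by (simp add: F_def G_def mult.assoc)
  qed
  have "continuous_on {0..} (\<lambda>t. F t - \<omega>^2 * G t)"
    using G by (intro continuous_intros F_cont DERIV_continuous_on[of "{0..}" G]) auto
  then show "continuous_on {0..} (y1 \<omega> f)"
    by (rule continuous_on_eq) (simp add: eq)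
  assume t: "t \<ge> 0"
  have "((\<lambda>t. - (\<omega>^2) * G t) has_real_derivative - (\<omega>^2) * y1 \<omega> f t) (at t within {0..})"
    using t by (auto intro!: derivative_eq_intros G simp: eq)
  then show "((\<lambda>t. y1 \<omega> f t - integral {0..t} f) has_real_derivative
      - (\<omega>^2) * y1 \<omega> f t) (at t within {0..})"
    by (rule has_field_derivative_transform_within[of _ _ _ _ 1]) (use t eq in \<open>auto simp: F_def\<close>)
qed

text \<open>Integrating factor: the derivative in \<open>s\<close> of
  \<open>exp (\<Phi> s - \<Phi> t) * w s\<close> is
  \<open>exp (\<Phi> s - \<Phi> t) * r s\<close>.\<close>

lemma linear_ode_solution:
  fixes \<Phi> \<Phi>' w r :: "real \<Rightarrow> real"
  assumes \<Phi>: "\<And>t. t \<ge> 0 \<Longrightarrow> (\<Phi> has_real_derivative \<Phi>' t) (at t within {0..})"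
    and w: "\<And>t. t \<ge> 0 \<Longrightarrow> (w has_real_derivative r t - \<Phi>' t * w t) (at t within {0..})"
    and "w 0 = 0" "t \<ge> 0"
  shows "w t = integral {0..t} (\<lambda>s. exp (\<Phi> s - \<Phi> t) * r s)"
proof -
  have "integral {0..t} (\<lambda>s. exp (\<Phi> s - \<Phi> t) * r s)
    = exp (\<Phi> t - \<Phi> t) * w t - exp (\<Phi> 0 - \<Phi> t) * w 0"
    using \<open>t \<ge> 0\<close>
    by (intro integral_derivative_atLeast)
       (auto intro!: derivative_eq_intros \<Phi> w simp: algebra_simps)
  then show ?thesis using \<open>w 0 = 0\<close> by simp
qed

text \<open>Variation of constants with weight \<open>exp (a * s - a * t)\<close>. The forcing is
  split because its two parts decay for different reasons: \<open>r\<close> tends to 0, whereas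
  \<open>r'\<close> has an integrable majorant.\<close>

lemma stable_linear_ode_tendsto_0:
  fixes w r r' m :: "real \<Rightarrow> real"
  assumes w: "\<And>t. t \<ge> 0 \<Longrightarrow> (w has_real_derivative r t + r' t - a * w t) (at t within {0..})"
    and w0: "w 0 = 0" and a: "a > 0"
    and r_cont: "continuous_on {0..} r" and r_lim: "(r \<longlongrightarrow> 0) at_top"
    and r'_cont: "continuous_on {0..} r'" and r'_le: "\<And>t. t \<ge> 0 \<Longrightarrow> \<bar>r' t\<bar> \<le> m t"
    and m_cont: "continuous_on {0..} m" and m_bound: "\<And>t. t \<ge> 0 \<Longrightarrow> integral {0..t} m \<le> C"
  shows "(w \<longlongrightarrow> 0) at_top"
proof -
  have lim: "filterlim (\<lambda>t. a * t) at_top at_top"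
    using a by (intro filterlim_tendsto_pos_mult_at_top[OF tendsto_const] filterlim_ident)
  have "((\<lambda>t. integral {0..t} (\<lambda>s. exp (a * s - a * t) * r s)) \<longlongrightarrow> 0) at_top"
    \<comment> \<open>The division by \<open>a\<close> in \<open>g\<close> offsets the factor
      \<open>\<Phi>' = a\<close> in the bound on the integrand.\<close>
    using a
    by (intro exp_weighted_integral_derivative_tendsto_0[where \<Phi>' = "\<lambda>_. a" and g = "\<lambda>s. r s / a"]
        continuous_intros lim r_cont tendsto_divide_zero r_lim)
       (auto intro!: derivative_eq_intros)
  moreover have "((\<lambda>t. integral {0..t} (\<lambda>s. exp (a * s - a * t) * r' s)) \<longlongrightarrow> 0) at_top"
    using a
    by (intro exp_weighted_integral_integrable_tendsto_0[OF _ lim _ r'_cont m_cont m_bound r'_le]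
        continuous_intros) auto
  ultimately have "((\<lambda>t. integral {0..t} (\<lambda>s. exp (a * s - a * t) * r s)
      + integral {0..t} (\<lambda>s. exp (a * s - a * t) * r' s)) \<longlongrightarrow> 0) at_top"
    using tendsto_add by fastforce
  moreover have "\<forall>\<^sub>F t in at_top. integral {0..t} (\<lambda>s. exp (a * s - a * t) * r s)
      + integral {0..t} (\<lambda>s. exp (a * s - a * t) * r' s) = w t"
    using eventually_ge_at_top[of 0]
  proof eventually_elim
    case (elim t)
    have "w t = integral {0..t} (\<lambda>s. exp (a * s - a * t) * (r s + r' s))"
      by (rule linear_ode_solution[where \<Phi>' = "\<lambda>_. a"])
         (use w w0 elim in \<open>auto intro!: derivative_eq_intros\<close>)
    also have "\<dots> = integral {0..t} (\<lambda>s. exp (a * s - a * t) * r s + exp (a * s - a * t) * r' s)"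
      by (simp add: distrib_left)
    also have "\<dots> = integral {0..t} (\<lambda>s. exp (a * s - a * t) * r s)
      + integral {0..t} (\<lambda>s. exp (a * s - a * t) * r' s)"
      by (intro integral_add integrable_continuous_atLeast[of 0] continuous_intros r_cont r'_cont) auto
    finally show ?case by simp
  qed
  ultimately show ?thesis by (rule Lim_transform_eventually)
qed

lemma bounded_atLeast_if_eventually_bounded:
  fixes g :: "real \<Rightarrow> real"
  assumes g: "continuous_on {0..} g" and T: "\<And>t. t \<ge> T \<Longrightarrow> \<bar>g t\<bar> \<le> K"
  obtains B where "B \<ge> 0" "\<And>t. t \<ge> 0 \<Longrightarrow> \<bar>g t\<bar> \<le> B"
proof -
  have "bounded (g ` {0..T})"
    by (intro compact_imp_bounded compact_continuous_image continuous_on_subset[OF g]) auto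
  then obtain B where B: "\<forall>t\<in>{0..T}. \<bar>g t\<bar> \<le> B"
    unfolding bounded_iff by auto
  show ?thesis
  proof
    fix t :: real assume "t \<ge> 0"
    then show "\<bar>g t\<bar> \<le> max 0 (max B K)"
      using bspec[OF B, of t] T[of t] by (cases "t \<le> T") (auto simp: le_max_iff_disj)
  qed simp
qed

lemma bounded_atLeast_if_tendsto_0:
  fixes g :: "real \<Rightarrow> real"
  assumes g: "continuous_on {0..} g" and lim: "(g \<longlongrightarrow> 0) at_top"
  obtains B where "B \<ge> 0" "\<And>t. t \<ge> 0 \<Longrightarrow> \<bar>g t\<bar> \<le> B"
proof -
  obtain T where "\<And>t. t \<ge> T \<Longrightarrow> \<bar>g t\<bar> < 1"
    using tendstoD[OF lim, of 1] by (auto simp: eventually_at_top_linorder)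
  then show ?thesis
    using bounded_atLeast_if_eventually_bounded[OF g, of T 1] that by (metis less_imp_le)
qed

section \<open>The damped oscillator\<close>

text \<open>The intended reading is \<open>v\<close> = x', \<open>y\<close> = y2 and
  \<open>z\<close> = y1. The forcing term is eliminated: it enters the derivatives of
  \<open>v\<close> and of \<open>z\<close> alike and cancels in \<open>v - z\<close>. Hence
  differentiability is asked of this difference, and only continuity of \<open>v\<close> and
  \<open>z\<close> themselves.\<close>

locale damped_oscillator =
  fixes \<omega> :: real and p p' x v y z :: "real \<Rightarrow> real"
  assumes omega_pos: "\<omega> > 0"
    and p_deriv: "\<And>t. t \<ge> 0 \<Longrightarrow> (p has_real_derivative p' t) (at t within {0..})"
    and p'_cont: "continuous_on {0..} p'"
    and p_pos: "\<And>t. t \<ge> 0 \<Longrightarrow> p t > 0"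
    and p'_neg: "\<And>t. t \<ge> 0 \<Longrightarrow> p' t < 0"
    and p_int_div: "filterlim (\<lambda>t. integral {0..t} p) at_top at_top"
    and p_sq_int: "(\<lambda>t. (p t)^2) integrable_on {0..}"
    and x_deriv: "\<And>t. t \<ge> 0 \<Longrightarrow> (x has_real_derivative v t) (at t within {0..})"
    and y_deriv: "\<And>t. t \<ge> 0 \<Longrightarrow> (y has_real_derivative z t - \<omega>^2 * y t) (at t within {0..})"
    and vz_deriv: "\<And>t. t \<ge> 0 \<Longrightarrow> ((\<lambda>t. v t - z t) has_real_derivative
      \<omega>^2 * z t - p t * v t - \<omega>^2 * x t) (at t within {0..})"
    and v_cont: "continuous_on {0..} v" and z_cont: "continuous_on {0..} z"
    and init: "x 0 = 0" "v 0 = 0" "y 0 = 0" "z 0 = 0"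
begin

section \<open>The damping weight and the integrable coefficient q\<close>

definition \<Phi> where "\<Phi> t = integral {0..t} p / 2"
text \<open>This is the perturbation in the Liouville normal form: formally, W = exp(\<Phi>) x
  satisfies W'' + (\<omega>^2 - q) W = exp(\<Phi>) f.\<close>

definition q where "q t = p' t / 2 + (p t)^2 / 4"
text \<open>Since \<open>p'\<close> is negative this is |p'|/2 + p^2/4, written without absolute
  values so that the first term integrates explicitly.\<close>

definition q_bound where "q_bound t = - p' t / 2 + (p t)^2 / 4"

lemma p_cont: "continuous_on {0..} p"
  and x_cont: "continuous_on {0..} x"
  and y_cont: "continuous_on {0..} y"
  using p_deriv x_deriv y_deriv by (auto intro!: DERIV_continuous_on)

lemma q_cont: "continuous_on {0..} q"
  and q_bound_cont: "continuous_on {0..} q_bound"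
  unfolding q_def[abs_def] q_bound_def[abs_def] by (intro continuous_intros p_cont p'_cont; simp)+

lemma \<Phi>_deriv: "t \<ge> 0 \<Longrightarrow> (\<Phi> has_real_derivative p t / 2) (at t within {0..})"
  unfolding \<Phi>_def[abs_def]
  by (intro DERIV_cdivide has_real_derivative_integral_atLeast p_cont)

lemma \<Phi>_cont: "continuous_on {0..} \<Phi>"
  using \<Phi>_deriv by (auto intro!: DERIV_continuous_on)

lemma Efac_eq:
  assumes "0 \<le> s" "s \<le> t"
  shows "Efac p t s = exp (\<Phi> s - \<Phi> t)"
proof -
  have "integral {0..t} p - integral {0..s} p = integral {s..t} p"
    by (intro integral_diff_subinterval integrable_continuous_atLeast[of 0] p_cont assms) simp
  then show ?thesis by (simp add: Efac_def \<Phi>_def field_simps)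
qed

lemma \<Phi>_mono:
  assumes "0 \<le> s" "s \<le> t"
  shows "\<Phi> s \<le> \<Phi> t"
proof -
  have "integral {0..t} p - integral {0..s} p = integral {s..t} p"
    by (intro integral_diff_subinterval integrable_continuous_atLeast[of 0] p_cont assms) simp
  moreover have "integral {s..t} p \<ge> 0"
    using assms p_pos
    by (intro integral_nonneg integrable_continuous_atLeast[of 0] p_cont) (auto intro: less_imp_le)
  ultimately show ?thesis by (simp add: \<Phi>_def)
qed

lemma \<Phi>_lim: "filterlim \<Phi> at_top at_top"
  using filterlim_tendsto_pos_mult_at_top[OF tendsto_const _ p_int_div, of "1 / 2"]
  by (simp add: \<Phi>_def[abs_def])

lemma integral_p': "t \<ge> 0 \<Longrightarrow> integral {0..t} p' = p t - p 0"
  using p_deriv by (rule integral_derivative_atLeast)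

lemma p_le:
  assumes "t \<ge> 0"
  shows "p t \<le> p 0"
proof -
  have "0 \<le> integral {0..t} (\<lambda>s. - p' s)"
    using p'_neg by (intro integral_nonneg integrable_continuous_atLeast[of 0] continuous_intros p'_cont)
      (auto intro: less_imp_le)
  then show ?thesis using integral_p'[OF assms] by simp
qed

lemma integral_abs_p'_le: "t \<ge> 0 \<Longrightarrow> integral {0..t} (\<lambda>s. - p' s) \<le> p 0"
  using integral_p'[of t] p_pos[of t] by simp

lemma abs_q_le: "t \<ge> 0 \<Longrightarrow> \<bar>q t\<bar> \<le> q_bound t"
  using p'_neg[of t] by (auto simp: q_def q_bound_def abs_if)

text \<open>The integral of \<open>- p'\<close> telescopes to \<open>p 0 - p t\<close>, which is
  below \<open>p 0\<close> by positivity of \<open>p\<close>; the square is integrable by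
  assumption.\<close>

lemma integral_q_bound_le:
  assumes "t \<ge> 0"
  shows "integral {0..t} q_bound \<le> p 0 / 2 + integral {0..} (\<lambda>t. (p t)^2) / 4"
proof -
  have int: "(\<lambda>s. (p s)^2) integrable_on {0..t}"
    by (intro integrable_continuous_atLeast[of 0] continuous_intros p_cont) simp
  have "integral {0..t} q_bound = integral {0..t} (\<lambda>s. (- p' s) * (1/2) + (p s)^2 * (1/4))"
    by (simp add: q_bound_def[abs_def])
  also have "\<dots> = integral {0..t} (\<lambda>s. (- p' s) * (1/2)) + integral {0..t} (\<lambda>s. (p s)^2 * (1/4))"
    by (intro integral_add integrable_continuous_atLeast[of 0] continuous_intros p_cont p'_cont) auto
  also have "integral {0..t} (\<lambda>s. (- p' s) * (1/2)) = integral {0..t} (\<lambda>s. - p' s) * (1/2)"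
    by (rule integral_mult_left)
  also have "integral {0..t} (\<lambda>s. (p s)^2 * (1/4)) = integral {0..t} (\<lambda>s. (p s)^2) * (1/4)"
    by (rule integral_mult_left)
  also have "integral {0..t} (\<lambda>s. (p s)^2) \<le> integral {0..} (\<lambda>t. (p t)^2)"
    by (intro integral_subset_le int p_sq_int) auto
  finally show ?thesis using integral_abs_p'_le[OF assms] by simp
qed

section \<open>Decay of x forces decay of y\<close>

text \<open>Two stable first-order equations with rate \<open>\<omega>^2\<close> are solved in
  succession, first for an auxiliary \<open>h\<close> forced by \<open>x\<close> alone, then for
  \<open>y - x\<close> forced by \<open>h\<close> and \<open>x\<close>.\<close>

lemma y_tendsto_0_if_x_tendsto_0:
  assumes x_lim: "(x \<longlongrightarrow> 0) at_top"
  shows "(y \<longlongrightarrow> 0) at_top"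
proof -
  have px_lim: "((\<lambda>t. p t * x t) \<longlongrightarrow> 0) at_top"
  proof (rule Lim_null_comparison)
    show "((\<lambda>t. p 0 * \<bar>x t\<bar>) \<longlongrightarrow> 0) at_top"
      using x_lim by (intro tendsto_mult_right_zero tendsto_rabs_zero)
    show "\<forall>\<^sub>F t in at_top. norm (p t * x t) \<le> p 0 * \<bar>x t\<bar>"
      using eventually_ge_at_top[of 0]
    proof eventually_elim
      case (elim t)
      then show ?case
        using p_le[of t] p_pos[of t] by (auto simp: abs_mult intro!: mult_right_mono)
    qed
  qed
  obtain B where B: "B \<ge> 0" "\<And>t. t \<ge> 0 \<Longrightarrow> \<bar>x t\<bar> \<le> B"
    using bounded_atLeast_if_tendsto_0[OF x_cont x_lim] by blast
  \<comment> \<open>The derivative of \<open>z - v\<close> contains \<open>p * v\<close> and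
    \<open>- \<omega>^2 * z\<close>. The summand \<open>- p * x\<close> cancels the former, and
    \<open>\<omega>^2 * x\<close> supplies the \<open>\<omega>^2 * v\<close> that turns the latter
    into a multiple of \<open>z - v\<close>. So h' + \<omega>^2 h involves only \<open>x\<close>,
    \<open>p * x\<close> and \<open>p' * x\<close>.\<close>
  define h where "h t = z t - v t + \<omega>^2 * x t - p t * x t" for t
  have h_deriv: "(h has_real_derivative (\<omega>^2 * x t - \<omega>^2 * (p t * x t) + (\<omega>^2)^2 * x t) + - (p' t * x t)
      - \<omega>^2 * h t) (at t within {0..})" if "t \<ge> 0" for t
  proof -
    have "((\<lambda>t. - (v t - z t) + \<omega>^2 * x t - p t * x t) has_real_derivative
      - (\<omega>^2 * z t - p t * v t - \<omega>^2 * x t) + \<omega>^2 * v t - (p' t * x t + v t * p t)) (at t within {0..})"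
      by (rule DERIV_diff[OF DERIV_add[OF DERIV_minus[OF vz_deriv] DERIV_cmult[OF x_deriv]]
            DERIV_mult[OF p_deriv x_deriv]] that)+
    then show ?thesis
      unfolding h_def[abs_def] by (simp add: algebra_simps power2_eq_square)
  qed
  have h_cont: "continuous_on {0..} h"
    using h_deriv by (auto intro!: DERIV_continuous_on)
  have h_lim: "(h \<longlongrightarrow> 0) at_top"
  proof (rule stable_linear_ode_tendsto_0[OF h_deriv])
    show "((\<lambda>t. \<omega>^2 * x t - \<omega>^2 * (p t * x t) + (\<omega>^2)^2 * x t) \<longlongrightarrow> 0) at_top"
      using tendsto_add[OF tendsto_diff tendsto_mult_right_zero, OF
          tendsto_mult_right_zero[OF x_lim] tendsto_mult_right_zero[OF px_lim] x_lim] by simp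
    show "integral {0..t} (\<lambda>s. B * (- p' s)) \<le> B * p 0" if "t \<ge> 0" for t
      using mult_left_mono[OF integral_abs_p'_le[OF that] B(1)] by simp
    show "\<bar>- (p' t * x t)\<bar> \<le> B * (- p' t)" if "t \<ge> 0" for t
      using mult_right_mono[OF B(2)[OF that], of "\<bar>p' t\<bar>"] p'_neg[OF that]
      by (simp add: abs_mult mult.commute)
  qed (use omega_pos init in \<open>auto simp: h_def intro!: continuous_intros p_cont p'_cont x_cont\<close>)
  have "((\<lambda>t. y t - x t) \<longlongrightarrow> 0) at_top"
  \<comment> \<open>Here (y - x)' = (z - v) - \<omega>^2 y, and z - v = h + p x - \<omega>^2 x by
    the choice of \<open>h\<close>. All forcing tends to 0, so the integrable part is set to
    zero.\<close>
  proof (rule stable_linear_ode_tendsto_0[where r = "\<lambda>t. h t + p t * x t - 2 * \<omega>^2 * x t"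
        and r' = "\<lambda>_. 0" and m = "\<lambda>_. 0" and a = "\<omega>^2" and C = 0])
    show "((\<lambda>t. y t - x t) has_real_derivative
       h t + p t * x t - 2 * \<omega>^2 * x t + 0 - \<omega>^2 * (y t - x t)) (at t within {0..})" if "t \<ge> 0" for t
      using that unfolding h_def
      by (auto intro!: derivative_eq_intros y_deriv x_deriv simp: algebra_simps)
    show "((\<lambda>t. h t + p t * x t - 2 * \<omega>^2 * x t) \<longlongrightarrow> 0) at_top"
      using tendsto_diff[OF tendsto_add[OF h_lim px_lim] tendsto_mult_right_zero[OF x_lim]] by simp
  qed (use omega_pos init in \<open>auto intro!: continuous_intros p_cont x_cont h_cont\<close>)
  then show ?thesis using tendsto_add[OF _ x_lim, of "\<lambda>t. y t - x t" 0] by simp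
qed

section \<open>The integral representation of x\<close>

text \<open>The parts of the integrand in the representation of \<open>x\<close> that are left over besides \<open>L3 \<omega> t s * y s\<close>.\<close>

definition y_kernel where
  "y_kernel t s = - p s * (cos (\<omega> * (t - s)) + \<omega> * sin (\<omega> * (t - s))) + sin (\<omega> * (t - s)) / \<omega> * q s"

definition x_kernel where
  "x_kernel t s = sin (\<omega> * (t - s)) / \<omega> * q s"

lemma kernel_cont:
  "continuous_on {0..} (\<lambda>s. y_kernel t s)" "continuous_on {0..} (\<lambda>s. x_kernel t s)"
  unfolding y_kernel_def x_kernel_def using omega_pos
  by (auto intro!: continuous_intros p_cont q_cont)

lemma L3_cont: "continuous_on A (\<lambda>s. L3 \<omega> t s)"
  unfolding L3_def by (intro continuous_intros)

text \<open>The pair (u, n) with u = x - y is a perturbation of the system u' = n, n' = - \<omega>^2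
  u damped at rate p/2. \<open>J\<close> applies the weighted propagator of that system, so
  differentiating it leaves only the perturbation terms. Integrating from 0 to \<open>t\<close>
  gives the claim, as \<open>J t = x t - y t\<close> and \<open>J 0 = 0\<close>.\<close>

lemma x_representation:
  assumes t: "t \<ge> 0"
  shows "x t = y t + integral {0..t} (\<lambda>s. Efac p t s * L3 \<omega> t s * y s)
    + integral {0..t} (\<lambda>s. exp (\<Phi> s - \<Phi> t) * (y_kernel t s * y s))
    + integral {0..t} (\<lambda>s. exp (\<Phi> s - \<Phi> t) * (x_kernel t s * x s))"
proof -
  (* n is chosen so that, with u = x - y, the expressions u' + (p/2) u - n and
     n' + (p/2) n + \<omega>^2 u involve only u and y, without y', and u only with the coefficient q. *)
  define n where "n s = (v s - z s) + (p s / 2 - \<omega>^2) * y s + p s / 2 * x s" for s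
  define n' where "n' s = - (p s / 2) * n s - \<omega>^2 * (x s - y s) + q s * (x s - y s)
    + ((\<omega>^2)^2 - \<omega>^2 - \<omega>^2 * p s + 2 * q s) * y s" for s
  have n_deriv: "(n has_real_derivative n' s) (at s within {0..})" if "s \<ge> 0" for s
    unfolding n_def[abs_def]
    by (rule derivative_eq_intros vz_deriv p_deriv x_deriv y_deriv that refl | simp)+
       (simp add: n'_def n_def q_def field_simps power2_eq_square)
  define u' where "u' s = n s - p s / 2 * (x s - y s) + (2 * \<omega>^2 - p s) * y s" for s
  have u_deriv: "((\<lambda>s. x s - y s) has_real_derivative u' s) (at s within {0..})" if "s \<ge> 0" for s
    using that by (auto intro!: derivative_eq_intros x_deriv y_deriv simp: u'_def n_def field_simps)
  define J where "J s = exp (\<Phi> s - \<Phi> t) *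
    (cos (\<omega> * (t - s)) * (x s - y s) + sin (\<omega> * (t - s)) / \<omega> * n s)" for s
  have J_deriv: "(J has_real_derivative exp (\<Phi> s - \<Phi> t) * (L3 \<omega> t s * y s)
      + exp (\<Phi> s - \<Phi> t) * (y_kernel t s * y s) + exp (\<Phi> s - \<Phi> t) * (x_kernel t s * x s))
      (at s within {0..})" if "s \<ge> 0" for s
  proof -
    have exp_deriv: "((\<lambda>s. exp (\<Phi> s - \<Phi> t)) has_real_derivative exp (\<Phi> s - \<Phi> t) * (p s / 2))
        (at s within {0..})"
      using that by (auto intro!: derivative_eq_intros \<Phi>_deriv)
    have cos_deriv: "((\<lambda>s. cos (\<omega> * (t - s))) has_real_derivative \<omega> * sin (\<omega> * (t - s))) (at s within {0..})"
      by (auto intro!: derivative_eq_intros)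
    have sin_deriv: "((\<lambda>s. sin (\<omega> * (t - s)) / \<omega>) has_real_derivative - cos (\<omega> * (t - s))) (at s within {0..})"
      using omega_pos by (auto intro!: derivative_eq_intros)
    have "(J has_real_derivative
      exp (\<Phi> s - \<Phi> t) * (p s / 2) * (cos (\<omega> * (t - s)) * (x s - y s) + sin (\<omega> * (t - s)) / \<omega> * n s)
      + (\<omega> * sin (\<omega> * (t - s)) * (x s - y s) + u' s * cos (\<omega> * (t - s))
        + (- cos (\<omega> * (t - s)) * n s + n' s * (sin (\<omega> * (t - s)) / \<omega>))) * exp (\<Phi> s - \<Phi> t))
      (at s within {0..})"
      unfolding J_def[abs_def]
      by (rule DERIV_mult[OF exp_deriv DERIV_add[OF DERIV_mult[OF cos_deriv u_deriv[OF that]]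
              DERIV_mult[OF sin_deriv n_deriv[OF that]]]])
    \<comment> \<open>In the coefficient of \<open>y s\<close>, the terms free of \<open>p\<close>
      and \<open>q\<close> are 2 \<omega>^2 cos + (\<omega>^4 - \<omega>^2) sin / \<omega>, which is
      \<open>L3\<close>. Of the \<open>2 * q s\<close> in \<open>n'\<close>, one copy is cancelled
      by \<open>q s * (x s - y s)\<close>, which also produces the \<open>x_kernel\<close>
      term.\<close>
    moreover have "exp (\<Phi> s - \<Phi> t) * (p s / 2) * (cos (\<omega> * (t - s)) * (x s - y s) + sin (\<omega> * (t - s)) / \<omega> * n s)
      + (\<omega> * sin (\<omega> * (t - s)) * (x s - y s) + u' s * cos (\<omega> * (t - s))
        + (- cos (\<omega> * (t - s)) * n s + n' s * (sin (\<omega> * (t - s)) / \<omega>))) * exp (\<Phi> s - \<Phi> t)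
      = exp (\<Phi> s - \<Phi> t) * (L3 \<omega> t s * y s)
      + exp (\<Phi> s - \<Phi> t) * (y_kernel t s * y s) + exp (\<Phi> s - \<Phi> t) * (x_kernel t s * x s)"
      using omega_pos unfolding u'_def n'_def L3_def y_kernel_def x_kernel_def
      by (simp add: field_simps power2_eq_square power3_eq_cube)
    ultimately show ?thesis by simp
  qed
  have "J t - J 0 = integral {0..t} (\<lambda>s. exp (\<Phi> s - \<Phi> t) * (L3 \<omega> t s * y s)
      + exp (\<Phi> s - \<Phi> t) * (y_kernel t s * y s) + exp (\<Phi> s - \<Phi> t) * (x_kernel t s * x s))"
    by (rule integral_derivative_atLeast[symmetric]) (use J_deriv t in auto)
  also have "\<dots> = integral {0..t} (\<lambda>s. exp (\<Phi> s - \<Phi> t) * (L3 \<omega> t s * y s)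
      + exp (\<Phi> s - \<Phi> t) * (y_kernel t s * y s))
      + integral {0..t} (\<lambda>s. exp (\<Phi> s - \<Phi> t) * (x_kernel t s * x s))"
    by (intro integral_add integrable_continuous_atLeast[of 0] continuous_intros \<Phi>_cont
          L3_cont kernel_cont x_cont y_cont) auto
  also have "integral {0..t} (\<lambda>s. exp (\<Phi> s - \<Phi> t) * (L3 \<omega> t s * y s)
      + exp (\<Phi> s - \<Phi> t) * (y_kernel t s * y s))
    = integral {0..t} (\<lambda>s. exp (\<Phi> s - \<Phi> t) * (L3 \<omega> t s * y s))
      + integral {0..t} (\<lambda>s. exp (\<Phi> s - \<Phi> t) * (y_kernel t s * y s))"
    by (intro integral_add integrable_continuous_atLeast[of 0] continuous_intros \<Phi>_cont
          L3_cont kernel_cont x_cont y_cont) auto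
  also have "integral {0..t} (\<lambda>s. exp (\<Phi> s - \<Phi> t) * (L3 \<omega> t s * y s))
    = integral {0..t} (\<lambda>s. Efac p t s * L3 \<omega> t s * y s)"
    by (rule Henstock_Kurzweil_Integration.integral_cong) (simp add: Efac_eq mult.assoc)
  finally show ?thesis
    using init by (simp add: J_def n_def)
qed

section \<open>Vanishing of the remainder integrals\<close>

lemma abs_x_kernel_le:
  assumes "s \<ge> 0"
  shows "\<bar>x_kernel t s\<bar> \<le> q_bound s / \<omega>"
proof -
  have "\<bar>sin (\<omega> * (t - s))\<bar> * \<bar>q s\<bar> \<le> 1 * q_bound s"
    using abs_q_le[OF assms] by (intro mult_mono) auto
  then show ?thesis
    using omega_pos by (simp add: x_kernel_def abs_mult divide_right_mono)
qed

text \<open>The kernel depends on \<open>t\<close> through sine and cosine, so it is first dominated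
  by functions of \<open>s\<close> alone. The part \<open>h1\<close> is of the form \<Phi>' times a
  null function, while \<open>h2\<close> has an integrable majorant because \<open>y\<close> is
  bounded.\<close>

lemma y_kernel_integral_tendsto_0:
  assumes y_lim: "(y \<longlongrightarrow> 0) at_top"
  shows "((\<lambda>t. integral {0..t} (\<lambda>s. exp (\<Phi> s - \<Phi> t) * (y_kernel t s * y s))) \<longlongrightarrow> 0) at_top"
proof -
  obtain B where B: "B \<ge> 0" "\<And>t. t \<ge> 0 \<Longrightarrow> \<bar>y t\<bar> \<le> B"
    using bounded_atLeast_if_tendsto_0[OF y_cont y_lim] by blast
  define h1 where "h1 s = p s * (1 + \<omega>) * \<bar>y s\<bar>" for s
  define h2 where "h2 s = q_bound s / \<omega> * \<bar>y s\<bar>" for s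
  have h1_cont: "continuous_on {0..} h1" and h2_cont: "continuous_on {0..} h2"
    unfolding h1_def[abs_def] h2_def[abs_def] using omega_pos
    by (auto intro!: continuous_intros p_cont y_cont q_bound_cont)
  have "((\<lambda>t. integral {0..t} (\<lambda>s. exp (\<Phi> s - \<Phi> t) * h1 s)) \<longlongrightarrow> 0) at_top"
  proof (rule exp_weighted_integral_derivative_tendsto_0[OF \<Phi>_deriv _ _ \<Phi>_lim h1_cont])
    \<comment> \<open>The factor 2 compensates for the derivative of \<open>\<Phi>\<close> being
      \<open>p / 2\<close>.\<close>
    show "((\<lambda>s. 2 * (1 + \<omega>) * y s) \<longlongrightarrow> 0) at_top"
      by (intro tendsto_mult_right_zero y_lim)
    show "\<bar>h1 s\<bar> \<le> p s / 2 * \<bar>2 * (1 + \<omega>) * y s\<bar>" if "s \<ge> 0" for s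
      using p_pos[OF that] omega_pos by (simp add: h1_def abs_mult) (simp add: algebra_simps)
    show "0 \<le> p t / 2" if "t \<ge> 0" for t using p_pos[OF that] by simp
  qed (auto intro!: continuous_intros p_cont)
  moreover have "((\<lambda>t. integral {0..t} (\<lambda>s. exp (\<Phi> s - \<Phi> t) * h2 s)) \<longlongrightarrow> 0) at_top"
  proof (rule exp_weighted_integral_integrable_tendsto_0[OF \<Phi>_cont \<Phi>_lim \<Phi>_mono h2_cont])
    show "continuous_on {0..} (\<lambda>s. q_bound s * (B / \<omega>))"
      by (intro continuous_intros q_bound_cont)
    show "integral {0..t} (\<lambda>s. q_bound s * (B / \<omega>))
      \<le> (p 0 / 2 + integral {0..} (\<lambda>t. (p t)^2) / 4) * (B / \<omega>)" if "t \<ge> 0" for t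
      unfolding integral_mult_left
      using integral_q_bound_le[OF that] B(1) omega_pos by (intro mult_right_mono) auto
    show "\<bar>h2 s\<bar> \<le> q_bound s * (B / \<omega>)" if "s \<ge> 0" for s
      using mult_left_mono[OF B(2)[OF that], of "q_bound s / \<omega>"] abs_q_le[OF that] omega_pos
      by (simp add: h2_def abs_mult)
  qed
  ultimately have lim: "((\<lambda>t. integral {0..t} (\<lambda>s. exp (\<Phi> s - \<Phi> t) * h1 s)
      + integral {0..t} (\<lambda>s. exp (\<Phi> s - \<Phi> t) * h2 s)) \<longlongrightarrow> 0) at_top"
    using tendsto_add by fastforce
  have "norm (integral {0..t} (\<lambda>s. exp (\<Phi> s - \<Phi> t) * (y_kernel t s * y s)))
     \<le> integral {0..t} (\<lambda>s. exp (\<Phi> s - \<Phi> t) * h1 s)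
      + integral {0..t} (\<lambda>s. exp (\<Phi> s - \<Phi> t) * h2 s)" for t
  proof -
    have *: "\<bar>y_kernel t s * y s\<bar> \<le> h1 s + h2 s" if "s \<ge> 0" for s
    proof -
      have "\<bar>cos (\<omega> * (t - s)) + \<omega> * sin (\<omega> * (t - s))\<bar> \<le> 1 + \<omega> * 1"
        using omega_pos mult_left_mono[OF abs_sin_le_one, of \<omega> "\<omega> * (t - s)"] abs_cos_le_one[of "\<omega> * (t - s)"]
        by (intro order_trans[OF abs_triangle_ineq] add_mono) (auto simp: abs_mult)
      then have "p s * \<bar>cos (\<omega> * (t - s)) + \<omega> * sin (\<omega> * (t - s))\<bar> \<le> p s * (1 + \<omega>)"
        using p_pos[OF that] by (intro mult_left_mono) auto
      moreover have "\<bar>y_kernel t s\<bar> \<le> p s * \<bar>cos (\<omega> * (t - s)) + \<omega> * sin (\<omega> * (t - s))\<bar> + \<bar>x_kernel t s\<bar>"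
        using abs_triangle_ineq[of "- p s * (cos (\<omega> * (t - s)) + \<omega> * sin (\<omega> * (t - s)))" "x_kernel t s"]
          p_pos[OF that]
        by (simp add: y_kernel_def x_kernel_def abs_mult)
      ultimately have "\<bar>y_kernel t s\<bar> \<le> p s * (1 + \<omega>) + q_bound s / \<omega>"
        using abs_x_kernel_le[OF that, of t] by linarith
      then have "\<bar>y_kernel t s\<bar> * \<bar>y s\<bar> \<le> (p s * (1 + \<omega>) + q_bound s / \<omega>) * \<bar>y s\<bar>"
        by (intro mult_right_mono) auto
      then show ?thesis by (simp add: h1_def h2_def abs_mult distrib_right)
    qed
    have "norm (integral {0..t} (\<lambda>s. exp (\<Phi> s - \<Phi> t) * (y_kernel t s * y s)))
      \<le> integral {0..t} (\<lambda>s. exp (\<Phi> s - \<Phi> t) * h1 s + exp (\<Phi> s - \<Phi> t) * h2 s)"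
      using *
      by (intro integral_norm_bound_integral integrable_continuous_atLeast[of 0] continuous_intros
          \<Phi>_cont kernel_cont y_cont h1_cont h2_cont) (auto simp: abs_mult simp flip: distrib_left)
    also have "\<dots> = integral {0..t} (\<lambda>s. exp (\<Phi> s - \<Phi> t) * h1 s)
      + integral {0..t} (\<lambda>s. exp (\<Phi> s - \<Phi> t) * h2 s)"
      by (intro integral_add integrable_continuous_atLeast[of 0] continuous_intros
          \<Phi>_cont h1_cont h2_cont) auto
    finally show ?thesis .
  qed
  then show ?thesis
    by (intro Lim_null_comparison[OF always_eventually lim]) auto
qed

lemma x_kernel_integral_le:
  assumes "t \<ge> 0"
  shows "\<bar>integral {0..t} (\<lambda>s. exp (\<Phi> s - \<Phi> t) * (x_kernel t s * x s))\<bar>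
    \<le> integral {0..t} (\<lambda>s. exp (\<Phi> s - \<Phi> t) * (q_bound s / \<omega> * \<bar>x s\<bar>))"
proof -
  have "norm (exp (\<Phi> s - \<Phi> t) * (x_kernel t s * x s)) \<le> exp (\<Phi> s - \<Phi> t) * (q_bound s / \<omega> * \<bar>x s\<bar>)"
    if "s \<in> {0..t}" for s
  proof -
    have "\<bar>x_kernel t s\<bar> * \<bar>x s\<bar> \<le> q_bound s / \<omega> * \<bar>x s\<bar>"
      using that by (intro mult_right_mono abs_x_kernel_le) auto
    from mult_left_mono[OF this, of "exp (\<Phi> s - \<Phi> t)"] show ?thesis by (simp add: abs_mult)
  qed
  then have "norm (integral {0..t} (\<lambda>s. exp (\<Phi> s - \<Phi> t) * (x_kernel t s * x s)))
    \<le> integral {0..t} (\<lambda>s. exp (\<Phi> s - \<Phi> t) * (q_bound s / \<omega> * \<bar>x s\<bar>))"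
    using omega_pos
    by (intro integral_norm_bound_integral integrable_continuous_atLeast[of 0] continuous_intros
          \<Phi>_cont kernel_cont x_cont q_bound_cont) auto
  then show ?thesis by simp
qed

text \<open>A bound on \<open>x\<close> suffices, since the decay comes from the integrability of
  \<open>q_bound\<close> and the weight.\<close>

lemma x_kernel_integral_tendsto_0:
  assumes B: "B \<ge> 0" "\<And>t. t \<ge> 0 \<Longrightarrow> \<bar>x t\<bar> \<le> B"
  shows "((\<lambda>t. integral {0..t} (\<lambda>s. exp (\<Phi> s - \<Phi> t) * (x_kernel t s * x s))) \<longlongrightarrow> 0) at_top"
proof (rule Lim_null_comparison)
  show "\<forall>\<^sub>F t in at_top. norm (integral {0..t} (\<lambda>s. exp (\<Phi> s - \<Phi> t) * (x_kernel t s * x s)))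
    \<le> integral {0..t} (\<lambda>s. exp (\<Phi> s - \<Phi> t) * (q_bound s / \<omega> * \<bar>x s\<bar>))"
    using eventually_ge_at_top[of 0] by eventually_elim (use x_kernel_integral_le in simp)
  show "((\<lambda>t. integral {0..t} (\<lambda>s. exp (\<Phi> s - \<Phi> t) * (q_bound s / \<omega> * \<bar>x s\<bar>))) \<longlongrightarrow> 0) at_top"
  proof (rule exp_weighted_integral_integrable_tendsto_0[OF \<Phi>_cont \<Phi>_lim \<Phi>_mono])
    show "continuous_on {0..} (\<lambda>s. q_bound s / \<omega> * \<bar>x s\<bar>)"
      using omega_pos by (auto intro!: continuous_intros q_bound_cont x_cont)
    show "continuous_on {0..} (\<lambda>s. q_bound s * (B / \<omega>))"
      by (intro continuous_intros q_bound_cont)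
    show "integral {0..t} (\<lambda>s. q_bound s * (B / \<omega>))
      \<le> (p 0 / 2 + integral {0..} (\<lambda>t. (p t)^2) / 4) * (B / \<omega>)" if "t \<ge> 0" for t
      unfolding integral_mult_left
      using integral_q_bound_le[OF that] B(1) omega_pos by (intro mult_right_mono) auto
    show "\<bar>q_bound s / \<omega> * \<bar>x s\<bar>\<bar> \<le> q_bound s * (B / \<omega>)" if "s \<ge> 0" for s
      using mult_left_mono[OF B(2)[OF that], of "q_bound s / \<omega>"] abs_q_le[OF that] omega_pos
      by (simp add: abs_mult)
  qed
qed

section \<open>A priori boundedness of x and the equivalence\<close>

text \<open>Far out, the integral term contributes at most half of the maximum of |x| over a compact
  interval, so it can be absorbed into the left-hand side at a point where that maximum is
  attained.\<close>

lemma x_bounded: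
  assumes b_lim: "(b \<longlongrightarrow> 0) at_top"
    and x_eq: "\<And>t. t \<ge> 0 \<Longrightarrow>
      x t = b t + integral {0..t} (\<lambda>s. exp (\<Phi> s - \<Phi> t) * (x_kernel t s * x s))"
  obtains B where "B \<ge> 0" "\<And>t. t \<ge> 0 \<Longrightarrow> \<bar>x t\<bar> \<le> B"
proof -
  have q_bound_nonneg: "q_bound s \<ge> 0" if "s \<ge> 0" for s using abs_q_le[OF that] by linarith
  \<comment> \<open>The kernel carries a factor 1/\<omega>, so the threshold
    \<open>\<omega> / 2\<close> yields a contraction factor of 1/2.\<close>
  obtain T1 where T1: "T1 \<ge> 0" "\<And>t. t \<ge> T1 \<Longrightarrow> integral {T1..t} q_bound \<le> \<omega> / 2"
    using integral_tail_le[OF q_bound_cont q_bound_nonneg integral_q_bound_le, of "\<omega> / 2"] omega_pos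
    by auto
  obtain T2 where T2: "\<And>t. t \<ge> T2 \<Longrightarrow> \<bar>b t\<bar> < 1"
    using tendstoD[OF b_lim, of 1] by (auto simp: eventually_at_top_linorder)
  define T where "T = max T1 T2"
  define w where "w s = q_bound s / \<omega> * \<bar>x s\<bar>" for s
  have w_cont: "continuous_on {0..} w"
    unfolding w_def[abs_def] using omega_pos by (auto intro!: continuous_intros q_bound_cont x_cont)
  have w_nonneg: "w s \<ge> 0" if "s \<ge> 0" for s
    using q_bound_nonneg[OF that] omega_pos by (simp add: w_def)
  define C where "C = integral {0..T1} w"
  have x_le: "\<bar>x t\<bar> \<le> 1 + C + integral {T1..t} w" if "t \<ge> T" for t
  proof -
    have t: "t \<ge> 0" "t \<ge> T1" "t \<ge> T2" using that T1 by (auto simp: T_def)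
    have "\<bar>x t\<bar> \<le> \<bar>b t\<bar> + \<bar>integral {0..t} (\<lambda>s. exp (\<Phi> s - \<Phi> t) * (x_kernel t s * x s))\<bar>"
      unfolding x_eq[OF t(1)] by (rule abs_triangle_ineq)
    also have "\<dots> \<le> 1 + integral {0..t} (\<lambda>s. exp (\<Phi> s - \<Phi> t) * w s)"
      using x_kernel_integral_le[OF t(1)] T2[OF t(3)] by (simp add: w_def)
    also have "integral {0..t} (\<lambda>s. exp (\<Phi> s - \<Phi> t) * w s) \<le> integral {0..t} w"
      using \<Phi>_mono w_nonneg
      by (intro integral_le integrable_continuous_atLeast[of 0] continuous_intros \<Phi>_cont w_cont)
         (auto intro!: mult_left_le_one_le)
    also have "integral {0..t} w = C + integral {T1..t} w"
      unfolding C_def using t T1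
      by (intro Henstock_Kurzweil_Integration.integral_combine[symmetric]
          integrable_continuous_atLeast[of 0] w_cont) auto
    finally show ?thesis by simp
  qed
  \<comment> \<open>At the maximum point \<open>r\<close> below, the estimate reads |x r| <= K/2 +
    |x r|/2, whence the factor 2.\<close>
  define K where "K = 2 * (1 + C + integral {T1..T} w)"
  have "\<bar>x t\<bar> \<le> K" if t: "t \<ge> T" for t
  proof -
    have T: "T \<ge> 0" "T \<ge> T1" using T1 by (auto simp: T_def)
    have "\<exists>r\<in>{T..t}. \<forall>s\<in>{T..t}. \<bar>x s\<bar> \<le> \<bar>x r\<bar>"
      using t T by (intro continuous_attains_sup continuous_intros continuous_on_subset[OF x_cont]) auto
    then obtain r where r: "T \<le> r" "r \<le> t" and r_max: "\<And>s. T \<le> s \<Longrightarrow> s \<le> t \<Longrightarrow> \<bar>x s\<bar> \<le> \<bar>x r\<bar>"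
      by auto
    have "integral {T..r} q_bound \<le> integral {T1..r} q_bound"
      using T T1 r q_bound_nonneg
      by (intro integral_subset_le integrable_continuous_atLeast[of 0] q_bound_cont) auto
    then have q_bound_le: "integral {T..r} q_bound \<le> \<omega> / 2"
      using T1(2)[of r] T r by linarith
    have "integral {T..r} w \<le> integral {T..r} (\<lambda>s. q_bound s * (\<bar>x r\<bar> / \<omega>))"
      using T r r_max q_bound_nonneg omega_pos
      by (intro integral_le integrable_continuous_atLeast[of 0] continuous_intros w_cont q_bound_cont)
         (auto simp: w_def intro!: divide_right_mono mult_left_mono)
    also have "\<dots> = integral {T..r} q_bound * (\<bar>x r\<bar> / \<omega>)" by simp
    also have "\<dots> \<le> \<omega> / 2 * (\<bar>x r\<bar> / \<omega>)"
      using q_bound_le omega_pos by (intro mult_right_mono) auto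
    finally have "integral {T..r} w \<le> \<bar>x r\<bar> / 2"
      using omega_pos by simp
    moreover have "integral {T1..r} w = integral {T1..T} w + integral {T..r} w"
      using T T1 r
      by (intro Henstock_Kurzweil_Integration.integral_combine[symmetric]
          integrable_continuous_atLeast[of 0] w_cont) auto
    ultimately have "\<bar>x r\<bar> \<le> K" using x_le[OF r(1)] by (simp add: K_def)
    then show ?thesis using r_max[OF t order_refl] by simp
  qed
  then show ?thesis
    using bounded_atLeast_if_eventually_bounded[OF x_cont] that by blast
qed

theorem x_tendsto_0_iff:
  "(x \<longlongrightarrow> 0) at_top \<longleftrightarrow> (y \<longlongrightarrow> 0) at_top \<and>
     ((\<lambda>t. integral {0..t} (\<lambda>s. Efac p t s * L3 \<omega> t s * y s)) \<longlongrightarrow> 0) at_top"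
proof -
  define I where "I t = integral {0..t} (\<lambda>s. Efac p t s * L3 \<omega> t s * y s)" for t
  define Y where "Y t = integral {0..t} (\<lambda>s. exp (\<Phi> s - \<Phi> t) * (y_kernel t s * y s))" for t
  define X where "X t = integral {0..t} (\<lambda>s. exp (\<Phi> s - \<Phi> t) * (x_kernel t s * x s))" for t
  have x_eq: "x t = y t + I t + Y t + X t" if "t \<ge> 0" for t
    unfolding I_def Y_def X_def by (rule x_representation[OF that])
  have "(x \<longlongrightarrow> 0) at_top \<longleftrightarrow> (y \<longlongrightarrow> 0) at_top \<and> (I \<longlongrightarrow> 0) at_top"
  proof safe
    assume x_lim: "(x \<longlongrightarrow> 0) at_top"
    show y_lim: "(y \<longlongrightarrow> 0) at_top" by (rule y_tendsto_0_if_x_tendsto_0[OF x_lim])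
    have Y_lim: "(Y \<longlongrightarrow> 0) at_top"
      unfolding Y_def[abs_def] by (rule y_kernel_integral_tendsto_0[OF y_lim])
    obtain B where "B \<ge> 0" "\<And>t. t \<ge> 0 \<Longrightarrow> \<bar>x t\<bar> \<le> B"
      using bounded_atLeast_if_tendsto_0[OF x_cont x_lim] by blast
    then have X_lim: "(X \<longlongrightarrow> 0) at_top"
      unfolding X_def[abs_def] by (rule x_kernel_integral_tendsto_0)
    have "((\<lambda>t. x t - y t - Y t - X t) \<longlongrightarrow> 0) at_top"
      using tendsto_diff[OF tendsto_diff[OF tendsto_diff[OF x_lim y_lim] Y_lim] X_lim] by simp
    moreover have "\<forall>\<^sub>F t in at_top. x t - y t - Y t - X t = I t"
      using eventually_ge_at_top[of 0] by eventually_elim (simp add: x_eq)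
    ultimately show "(I \<longlongrightarrow> 0) at_top" by (rule Lim_transform_eventually)
  next
    assume y_lim: "(y \<longlongrightarrow> 0) at_top" and I_lim: "(I \<longlongrightarrow> 0) at_top"
    have Y_lim: "(Y \<longlongrightarrow> 0) at_top"
      unfolding Y_def[abs_def] by (rule y_kernel_integral_tendsto_0[OF y_lim])
    have b_lim: "((\<lambda>t. y t + I t + Y t) \<longlongrightarrow> 0) at_top"
      using tendsto_add[OF tendsto_add[OF y_lim I_lim] Y_lim] by simp
    \<comment> \<open>In this direction the bound on \<open>x\<close> has to come from the
      representation itself, with the three null terms collected into one inhomogeneity.\<close>
    obtain B where "B \<ge> 0" "\<And>t. t \<ge> 0 \<Longrightarrow> \<bar>x t\<bar> \<le> B"
      using x_bounded[OF b_lim] x_eq unfolding X_def by blast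
    then have X_lim: "(X \<longlongrightarrow> 0) at_top"
      unfolding X_def[abs_def] by (rule x_kernel_integral_tendsto_0)
    have "((\<lambda>t. y t + I t + Y t + X t) \<longlongrightarrow> 0) at_top"
      using tendsto_add[OF b_lim X_lim] by simp
    moreover have "\<forall>\<^sub>F t in at_top. y t + I t + Y t + X t = x t"
      using eventually_ge_at_top[of 0] by eventually_elim (simp add: x_eq)
    ultimately show "(x \<longlongrightarrow> 0) at_top" by (rule Lim_transform_eventually)
  qed
  then show ?thesis unfolding I_def[abs_def] .
qed

end

section \<open>Reduction of the forced equation to the oscillator\<close>

text \<open>The differential equation is stated in integrated form because \<open>f\<close> is only
  locally integrable, so that \<open>x'\<close> need not be differentiable at every point.\<close>

theorem mainTheorem15:
  fixes \<omega> :: real and p p' f x x' :: "real \<Rightarrow> real"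
  assumes omega_pos: "\<omega> > 0"
    and p_deriv: "\<And>t. t \<ge> 0 \<Longrightarrow> (p has_real_derivative p' t) (at t within {0..})"
    and p'_cont: "continuous_on {0..} p'"
    and p_pos: "\<And>t. t \<ge> 0 \<Longrightarrow> p t > 0"
    and p'_neg: "\<And>t. t \<ge> 0 \<Longrightarrow> p' t < 0"
    and p_int_div: "filterlim (\<lambda>t. integral {0..t} p) at_top at_top"
    and p_sq_int: "(\<lambda>t. (p t)^2) integrable_on {0..}"
    and f_loc: "\<And>t. t \<ge> 0 \<Longrightarrow> f absolutely_integrable_on {0..t}"
    and x_deriv: "\<And>t. t \<ge> 0 \<Longrightarrow> (x has_real_derivative x' t) (at t within {0..})"
    and x_eq: "\<And>t. t \<ge> 0 \<Longrightarrow>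
        ((\<lambda>s. f s - p s * x' s - \<omega>^2 * x s) has_integral (x' t - x' 0)) {0..t}"
    and x0: "x 0 = 0" and x'0: "x' 0 = 0"
  shows "(x \<longlongrightarrow> 0) at_top \<longleftrightarrow>
           ((y2 \<omega> f \<longlongrightarrow> 0) at_top \<and>
            ((\<lambda>t. integral {0..t} (\<lambda>s. Efac p t s * L3 \<omega> t s * y2 \<omega> f s)) \<longlongrightarrow> 0) at_top)"
proof -
  have f_int: "f integrable_on {0..t}" if "t \<ge> 0" for t
    using f_loc[OF that] by (rule set_lebesgue_integral_eq_integral(1))
  have p_cont: "continuous_on {0..} p" and x_cont: "continuous_on {0..} x"
    using p_deriv x_deriv by (auto intro!: DERIV_continuous_on)
  have x'_eq: "x' t = integral {0..t} (\<lambda>s. f s - p s * x' s - \<omega>^2 * x s)" if "t \<ge> 0" for t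
    using integral_unique[OF x_eq[OF that]] x'0 by simp
  have x'_cont: "continuous_on {0..} x'"
  proof (rule continuous_on_eq)
    show "continuous_on {0..} (\<lambda>t. integral {0..t} (\<lambda>s. f s - p s * x' s - \<omega>^2 * x s))"
      using x_eq by (intro continuous_on_integral_atLeast) (rule has_integral_integrable)
  qed (simp add: x'_eq)
  have z_cont: "continuous_on {0..} (y1 \<omega> f)" by (rule continuous_on_y1[OF f_loc])
  have r_cont: "continuous_on {0..} (\<lambda>s. p s * x' s + \<omega>^2 * x s)"
    by (intro continuous_intros p_cont x'_cont x_cont)
  have x'_diff: "integral {0..t} f - integral {0..t} (\<lambda>s. p s * x' s + \<omega>^2 * x s) = x' t" if "t \<ge> 0" for t
    using integral_diff[OF f_int[OF that] integrable_continuous_atLeast[OF r_cont order_refl]] x'_eq[OF that]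
    by (simp add: diff_diff_eq)
  \<comment> \<open>Both \<open>x'\<close> and \<open>y1\<close> equal the indefinite integral of
    \<open>f\<close> plus a differentiable function; it drops out of the difference, which is
    therefore differentiable everywhere.\<close>
  have "((\<lambda>t. x' t - y1 \<omega> f t) has_real_derivative
      \<omega>^2 * y1 \<omega> f t - p t * x' t - \<omega>^2 * x t) (at t within {0..})" if t: "t \<ge> 0" for t
  proof -
    have "((\<lambda>t. - (y1 \<omega> f t - integral {0..t} f) - integral {0..t} (\<lambda>s. p s * x' s + \<omega>^2 * x s))
      has_real_derivative - (- (\<omega>^2) * y1 \<omega> f t) - (p t * x' t + \<omega>^2 * x t)) (at t within {0..})"
      by (intro derivative_intros DERIV_minus DERIV_diff has_real_derivative_y1_minus_integral[OF f_loc]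
          has_real_derivative_integral_atLeast r_cont t)
    then have "((\<lambda>t. x' t - y1 \<omega> f t) has_real_derivative
      - (- (\<omega>^2) * y1 \<omega> f t) - (p t * x' t + \<omega>^2 * x t)) (at t within {0..})"
      by (rule has_field_derivative_transform_within[of _ _ _ _ 1]) (use t in \<open>auto simp flip: x'_diff\<close>)
    then show ?thesis by (simp add: algebra_simps)
  qed
  moreover have "(y2 \<omega> f has_real_derivative y1 \<omega> f t - \<omega>^2 * y2 \<omega> f t) (at t within {0..})"
    if "t \<ge> 0" for t
    unfolding y2_def[abs_def] by (rule has_real_derivative_exp_convolution[OF z_cont that])
  ultimately interpret damped_oscillator \<omega> p p' x x' "y2 \<omega> f" "y1 \<omega> f"
    using assms x'_cont z_cont by unfold_locales (auto simp: y1_def y2_def)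
  show ?thesis by (rule x_tendsto_0_iff)
qed

end
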